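(* Let $f,g\in\mathcal O_K$. 1. If $f,g\in\mathcal O_K^0$, then $|f|_\theta|g|_\theta\le|fg|_\theta\le\theta|f|_\theta|g|_\theta$. 2. If $f,g\in\mathcal O_K^1$, then $|f|_\theta|g|_\theta\le|fg|_\theta\le\theta^2|f|_\theta|g|_\theta$. 3. If $f\in\mathcal O_K^0$ and $g\in\mathcal O_K^1$, then $|f|_\theta|g|_\theta\le|fg|_\theta\le\theta|f|_\theta|g|_\theta$.
   Context: $\theta>1$ is a real quadratic unit with $N(\theta)=1$, so $\theta^2=a\theta-1$ with an integer $a\ge3$ and the conjugate is $\theta'=\theta^{-1}$; $K=\mathbb Q(\theta)\subset\mathbb R$, $\mathcal O_K$ its ring of integers, $\alpha'$ the Galois conjugate of $\alpha$. A greedy polynomial is a finite sum $\sum_{i=m}^M b_i\theta^i$ with $b_i\in\{0,\dots,a-1\}$ containing no digit subword $b_ib_{i-1}\cdots b_{i-k}$ ($k\ge1$) of the form $(a-1)(a-2)\cdots(a-2)(a-1)$ (including $(a-1)(a-1)$). Let $\mathcal O_K^0=\{\alpha\in\mathcal O_K:\operatorname{sgn}\alpha=\operatorname{sgn}\alpha'\}\cup\{0\}$ and $\mathcal O_K^1=\{\alpha\in\mathcal O_K:\operatorname{sgn}\alpha\ne\operatorname{sgn}\alpha'\}\cup\{0\}$. Each nonzero $\alpha\in\mathcal O_K^0$ can be written uniquely as $\alpha=\pm\sum_{i=m}^Mb_i\theta^i$, a greedy polynomial with $b_m\neq0$; set $|\alpha|_\theta=\theta^{-m}$ and $|0|_\theta=0$.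 Let $T=\theta-1$; for $\alpha\in\mathcal O_K^1$ one has $T\alpha\in\mathcal O_K^0$ and one defines $|\alpha|_\theta:=|T\alpha|_\theta$.
   Formalization: Greedy expansions exist only in Z[θ], which can be smaller than O_K (a=6: 2+√2 has none), so the formal theorem assumes |f|, |g|, |fg| are defined: each element lies in Z[θ] if in O_K^0, or T times it does if in O_K^1; automatic if O_K = Z[θ]. *)

theory Defs
  imports "HOL-Computational_Algebra.Computational_Algebra"
begin

text \<open>
  Throughout, \<open>\<theta>\<close> is a real number with \<open>\<theta>\<^sup>2 = a * \<theta> - 1\<close>, \<open>\<theta> > 1\<close>, for an integer \<open>a \<ge> 3\<close>.
  These assumptions are made where the definitions are used; they imply that \<open>\<theta>\<close> is irrational
  and that its conjugate is \<open>inverse \<theta>\<close>.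
\<close>

definition quad_field :: "real \<Rightarrow> real set" where
  "quad_field \<theta> = {p + q * \<theta> | p q. p \<in> \<rat> \<and> q \<in> \<rat>}"

definition galois_conj :: "real \<Rightarrow> real \<Rightarrow> real" where
  "galois_conj \<theta> \<alpha> = (THE \<beta>. \<exists>p\<in>\<rat>. \<exists>q\<in>\<rat>. \<alpha> = p + q * \<theta> \<and> \<beta> = p + q * inverse \<theta>)"

definition O_K :: "real \<Rightarrow> real set" where
  "O_K \<theta> = {\<alpha> \<in> quad_field \<theta>. algebraic_int \<alpha>}"

definition O_K0 :: "real \<Rightarrow> real set" where
  "O_K0 \<theta> = {\<alpha> \<in> O_K \<theta>. sgn \<alpha> = sgn (galois_conj \<theta> \<alpha>)} \<union> {0}"

definition O_K1 :: "real \<Rightarrow> real set" where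
  "O_K1 \<theta> = {\<alpha> \<in> O_K \<theta>. sgn \<alpha> \<noteq> sgn (galois_conj \<theta> \<alpha>)} \<union> {0}"

text \<open>
  The digits \<open>b m, \<dots>, b M\<close> lie in \<open>{0, \<dots>, a - 1}\<close>, and no subword \<open>b i, b (i - 1), \<dots>, b (i - k)\<close>
  with \<open>k \<ge> 1\<close> has the form \<open>(a - 1) (a - 2) \<dots> (a - 2) (a - 1)\<close>; here \<open>j = i - k\<close>.
\<close>

definition greedy_digits :: "int \<Rightarrow> int \<Rightarrow> int \<Rightarrow> (int \<Rightarrow> int) \<Rightarrow> bool" where
  "greedy_digits a m M b \<longleftrightarrow>
     (\<forall>i\<in>{m..M}. b i \<in> {0..a - 1}) \<and>
     \<not> (\<exists>i j. m \<le> j \<and> j < i \<and> i \<le> M \<and> b i = a - 1 \<and> b j = a - 1 \<and>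
              (\<forall>l\<in>{j<..<i}. b l = a - 2))"

definition has_lowest_exponent :: "int \<Rightarrow> real \<Rightarrow> real \<Rightarrow> int \<Rightarrow> bool" where
  "has_lowest_exponent a \<theta> \<alpha> m \<longleftrightarrow>
     (\<exists>M b s. m \<le> M \<and> greedy_digits a m M b \<and> b m \<noteq> 0 \<and> s \<in> {1, -1} \<and>
        \<alpha> = s * (\<Sum>i=m..M. of_int (b i) * \<theta> powi i))"

definition abs_theta0 :: "int \<Rightarrow> real \<Rightarrow> real \<Rightarrow> real" where
  "abs_theta0 a \<theta> \<alpha> =
     (if \<alpha> = 0 then 0 else \<theta> powi (- (THE m. has_lowest_exponent a \<theta> \<alpha> m)))"

definition abs_theta :: "int \<Rightarrow> real \<Rightarrow> real \<Rightarrow> real" where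
  "abs_theta a \<theta> \<alpha> =
     (if \<alpha> \<in> O_K0 \<theta> then abs_theta0 a \<theta> \<alpha> else abs_theta0 a \<theta> ((\<theta> - 1) * \<alpha>))"

definition Z_theta :: "real \<Rightarrow> real set" where
  "Z_theta \<theta> = {of_int x + of_int y * \<theta> | x y :: int. True}"

text \<open>
  Since \<open>inverse \<theta> = a - \<theta>\<close>, every greedy polynomial lies in \<open>Z_theta \<theta>\<close>, which may be a proper
  subring of \<open>O_K \<theta>\<close>: for \<open>a = 6\<close>, \<open>\<theta> = 3 + 2 * sqrt 2\<close>, the element \<open>2 + sqrt 2\<close> of
  \<open>O_K0 \<theta>\<close> has no greedy expansion. The following set is the domain on which \<open>abs_theta\<close>
  is meaningful; it is all of \<open>O_K0 \<theta> \<union> O_K1 \<theta> = O_K \<theta>\<close> if \<open>O_K \<theta> = Z_theta \<theta>\<close>.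
\<close>

definition abs_theta_domain :: "real \<Rightarrow> real set" where
  "abs_theta_domain \<theta> =
     {\<alpha> \<in> O_K0 \<theta>. \<alpha> \<in> Z_theta \<theta>} \<union> {\<alpha> \<in> O_K1 \<theta>. (\<theta> - 1) * \<alpha> \<in> Z_theta \<theta>}"

end

theory Submission
  imports Defs
begin

text \<open>
  On totally positive elements the absolute value only depends on the size of the conjugate:
  conjugation reverses a greedy sum with lowest exponent \<open>m\<close>, and the forbidden words are exactly
  those that would let the reversed sum reach \<open>\<theta> powi (1 - m)\<close>. Hence \<open>|\<alpha>|\<^sub>\<theta>\<close> is \<open>|\<alpha>'|\<close>
  rounded down to a power of \<open>\<theta>\<close>, and the estimates are those for the floor of a sum of two
  real numbers; for two factors in \<open>O_K1\<close> one also needs \<open>|T'|\<^sup>2 \<ge> inverse \<theta>\<close>.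

  A totally positive element of \<open>Z_theta\<close> lies in a cone spanned by \<open>\<theta> powi i\<close> and
  \<open>\<theta> powi (i + 1)\<close>, so it is a sum of powers of \<open>\<theta>\<close>. A shortest such sum is greedy, because
  a forbidden word (or a digit \<open>\<ge> a\<close>) from \<open>j\<close> to \<open>i\<close> has the same value as
  \<open>\<theta> powi (i + 1) + \<theta> powi (j - 1)\<close>.
\<close>

section \<open>Auxiliary facts on powers, multisets and greedy words\<close>

lemma int_power_bracket:
  fixes b x :: real
  assumes "b > 1" "x > 0"
  obtains k :: int where "b powi k \<le> x" "x < b powi (k + 1)"
proof -
  define k where "k = \<lfloor>log b x\<rfloor>"
  have "b powr k \<le> x \<and> x < b powr (k + 1)"
    using floor_log_eq_powr_iff[OF assms(2,1)] k_def by blast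
  moreover have "b powr real_of_int n = b powi n" for n
    using assms by (simp add: powr_real_of_int')
  from this[of k] this[of "k + 1"]
  have "b powr k = b powi k" "b powr (k + 1) = b powi (k + 1)"
    by simp_all
  ultimately show ?thesis
    using that[of k] by simp
qed

lemma power_int_less_cancel:
  fixes b :: real
  assumes "b > 1" "b powi m < b powi n"
  shows "m < n"
  using assms power_int_increasing[of n m b] by (meson less_eq_real_def not_le)

lemma sum_mset_eq_sum_count:
  fixes f :: "'a \<Rightarrow> 'b :: semiring_1"
  assumes "finite A" "set_mset C \<subseteq> A"
  shows "(\<Sum>x\<in>#C. f x) = (\<Sum>x\<in>A. of_nat (count C x) * f x)"
  using assms(2)
proof (induction C)
  case empty
  show ?case by simp
next
  case (add y C)
  have "(\<Sum>x\<in>A. of_nat (count (add_mset y C) x) * f x) =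
      (\<Sum>x\<in>A. (if x = y then f y else 0) + of_nat (count C x) * f x)"
    by (intro sum.cong) (auto simp: algebra_simps)
  then show ?case
    using add assms(1) by (simp add: sum.distrib)
qed

lemma greedy_digits_mono:
  assumes "greedy_digits a m M b" "m \<le> n"
  shows "greedy_digits a n M b"
proof -
  have "\<forall>i\<in>{n..M}. b i \<in> {0..a - 1}"
    using assms unfolding greedy_digits_def by auto
  then show ?thesis
    using assms unfolding greedy_digits_def by (meson order_trans)
qed

section \<open>Conjugation and arithmetic in the quadratic field\<close>

definition is_conj :: "real \<Rightarrow> real \<Rightarrow> real \<Rightarrow> bool" where
  "is_conj \<theta> \<alpha> \<beta> \<longleftrightarrow> (\<exists>p\<in>\<rat>. \<exists>q\<in>\<rat>. \<alpha> = p + q * \<theta> \<and> \<beta> = p + q * inverse \<theta>)"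

lemma is_conjI: "p \<in> \<rat> \<Longrightarrow> q \<in> \<rat> \<Longrightarrow> is_conj \<theta> (p + q * \<theta>) (p + q * inverse \<theta>)"
  unfolding is_conj_def by blast

lemma is_conj_add:
  assumes "is_conj \<theta> \<alpha> \<beta>" "is_conj \<theta> \<gamma> \<delta>"
  shows "is_conj \<theta> (\<alpha> + \<gamma>) (\<beta> + \<delta>)"
proof -
  obtain p q r s where "p \<in> \<rat>" "q \<in> \<rat>" "r \<in> \<rat>" "s \<in> \<rat>"
    and "\<alpha> = p + q * \<theta>" "\<beta> = p + q * inverse \<theta>" "\<gamma> = r + s * \<theta>" "\<delta> = r + s * inverse \<theta>"
    using assms unfolding is_conj_def by blast
  then show ?thesis
    using is_conjI[of "p + r" "q + s" \<theta>] by (simp add: algebra_simps)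
qed

lemma is_conj_rat: "r \<in> \<rat> \<Longrightarrow> is_conj \<theta> r r"
  using is_conjI[of r 0 \<theta>] by simp

lemma is_conj_sum:
  assumes "\<And>i. i \<in> I \<Longrightarrow> is_conj \<theta> (f i) (g i)"
  shows "is_conj \<theta> (\<Sum>i\<in>I. f i) (\<Sum>i\<in>I. g i)"
  using assms
  by (induction I rule: infinite_finite_induct) (auto intro: is_conj_add is_conj_rat)

locale quadratic_unit =
  fixes a :: int and \<theta> :: real
  assumes a_ge: "a \<ge> 3" and theta_gt: "\<theta> > 1" and theta_sq: "\<theta>\<^sup>2 = of_int a * \<theta> - 1"
begin

lemma theta_inverse: "inverse \<theta> = of_int a - \<theta>"
  using theta_gt theta_sq by (simp add: field_simps power2_eq_square)

lemma powi_Suc: "\<theta> powi (k + 1) = \<theta> * \<theta> powi k"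
  using theta_gt by (simp add: power_int_add)

text \<open>The quadratic equation, read as a three-term recurrence with integer coefficients. It
  drives both the forbidden-word identity and the change of basis in \<open>Z_theta\<close>.\<close>

lemma powi_diff_1: "\<theta> powi (k - 1) = of_int a * \<theta> powi k - \<theta> powi (k + 1)"
proof -
  have "\<theta> powi (k - 1) = inverse \<theta> * \<theta> powi k"
    using theta_gt by (simp add: power_int_diff field_simps)
  then show ?thesis
    by (simp only: theta_inverse powi_Suc left_diff_distrib)
qed

text \<open>A rational algebraic integer is an integer \<open>t\<close>. The quadratic equation then
  reads \<open>t * (a - t) = 1\<close>, so \<open>t\<close> divides 1, contradicting
  \<open>\<theta> > 1\<close>.\<close>

lemma theta_not_rat: "\<theta> \<notin> \<rat>"
proof
  assume rat: "\<theta> \<in> \<rat>"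
  have "algebraic_int \<theta>"
  proof (rule algebraic_int.intros)
    show "lead_coeff [:1, - of_int a, 1:] = (1 :: real)" by simp
    show "\<forall>i. coeff [:1, - of_int a, 1 :: real:] i \<in> \<int>"
      by (auto simp: coeff_pCons split: nat.split)
    show "poly [:1, - of_int a, 1:] \<theta> = 0"
      using theta_sq by (simp add: algebra_simps power2_eq_square)
  qed
  then obtain t where t: "\<theta> = of_int t"
    using rat rational_algebraic_int_is_int Ints_cases by metis
  have "real_of_int (t * (a - t)) = of_int 1"
    using theta_sq t by (simp add: algebra_simps power2_eq_square)
  then have "t * (a - t) = 1"
    by (simp only: of_int_eq_iff)
  then have "t dvd 1"
    by (metis dvd_triv_left)
  then show False
    using t theta_gt by auto
qed

lemma rat_combination_eq_0:
  assumes "p \<in> \<rat>" "q \<in> \<rat>" "p + q * \<theta> = 0"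
  shows "p = 0" "q = 0"
proof -
  show "q = 0"
  proof (rule ccontr)
    assume "q \<noteq> 0"
    then have "\<theta> = - p / q" using assms(3) by (simp add: field_simps)
    then show False using theta_not_rat assms(1,2) by simp
  qed
  then show "p = 0" using assms(3) by simp
qed

lemma is_conj_swap: "is_conj \<theta> \<alpha> \<beta> \<Longrightarrow> is_conj \<theta> \<beta> \<alpha>"
proof -
  assume "is_conj \<theta> \<alpha> \<beta>"
  then obtain p q where "p \<in> \<rat>" "q \<in> \<rat>" and eq: "\<alpha> = p + q * \<theta>" "\<beta> = p + q * inverse \<theta>"
    unfolding is_conj_def by blast
  then show ?thesis
    \<comment> \<open>The new coefficients come from substituting
      \<open>inverse \<theta> = a - \<theta>\<close>.\<close>
    unfolding eq using is_conjI[of "p + q * of_int a" "- q" \<theta>] by (simp add: theta_inverse algebra_simps)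
qed

lemma is_conj_unique:
  assumes "is_conj \<theta> \<alpha> \<beta>" "is_conj \<theta> \<alpha> \<gamma>"
  shows "\<beta> = \<gamma>"
proof -
  obtain p q r s where rat: "p \<in> \<rat>" "q \<in> \<rat>" "r \<in> \<rat>" "s \<in> \<rat>"
    and eq: "\<alpha> = p + q * \<theta>" "\<beta> = p + q * inverse \<theta>" "\<alpha> = r + s * \<theta>" "\<gamma> = r + s * inverse \<theta>"
    using assms unfolding is_conj_def by blast
  have "(p - r) + (q - s) * \<theta> = 0"
    using eq by (simp add: algebra_simps)
  then have "p - r = 0" "q - s = 0"
    using rat_combination_eq_0[of "p - r" "q - s"] rat by auto
  then show ?thesis using eq by simp
qed

lemma is_conj_mult:
  assumes "is_conj \<theta> \<alpha> \<beta>" "is_conj \<theta> \<gamma> \<delta>"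
  shows "is_conj \<theta> (\<alpha> * \<gamma>) (\<beta> * \<delta>)"
proof -
  obtain p q r s where rat: "p \<in> \<rat>" "q \<in> \<rat>" "r \<in> \<rat>" "s \<in> \<rat>"
    and eq: "\<alpha> = p + q * \<theta>" "\<beta> = p + q * inverse \<theta>" "\<gamma> = r + s * \<theta>" "\<delta> = r + s * inverse \<theta>"
    using assms unfolding is_conj_def by blast
  \<comment> \<open>Since \<open>\<theta>\<close> and \<open>inverse \<theta>\<close> are roots of
    the same quadratic, one expansion serves both the product and its conjugate.\<close>
  have expand: "(p + q * t) * (r + s * t) = (p * r - q * s) + (p * s + q * r + q * s * of_int a) * t"
    if "t\<^sup>2 = of_int a * t - 1" for t
  proof -
    have "(p + q * t) * (r + s * t) = p * r + (p * s + q * r) * t + q * s * t\<^sup>2"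
      by (simp add: algebra_simps power2_eq_square)
    then show ?thesis
      unfolding that by (simp add: algebra_simps)
  qed
  have "(inverse \<theta>)\<^sup>2 = of_int a * inverse \<theta> - 1"
    using theta_sq by (simp add: theta_inverse power2_eq_square algebra_simps)
  then show ?thesis
    using rat expand theta_sq unfolding eq by (simp add: is_conjI)
qed

lemma is_conj_0_iff:
  assumes "is_conj \<theta> \<alpha> \<beta>"
  shows "\<alpha> = 0 \<longleftrightarrow> \<beta> = 0"
  using assms is_conj_swap[OF assms] is_conj_unique[OF _ is_conj_rat[OF Rats_0]] by blast

lemma is_conj_powi: "is_conj \<theta> (\<theta> powi k) (\<theta> powi (- k))"
proof -
  have base: "is_conj \<theta> \<theta> (inverse \<theta>)"
    using is_conjI[of 0 1 \<theta>] by simp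
  show ?thesis
  proof (induction k rule: int_induct[where k = 0])
    case base
    then show ?case using is_conj_rat[of 1] by simp
  next
    case (step1 i)
    moreover have "\<theta> powi (- (i + 1)) = inverse \<theta> * \<theta> powi (- i)"
      using theta_gt by (simp only: power_int_minus powi_Suc inverse_mult_distrib)
    ultimately show ?case
      using is_conj_mult[OF base] by (simp only: powi_Suc)
  next
    case (step2 i)
    moreover have "\<theta> powi (i - 1) = inverse \<theta> * \<theta> powi i"
      using theta_gt by (simp add: power_int_diff divide_inverse mult.commute)
    moreover have "\<theta> powi (- (i - 1)) = \<theta> * \<theta> powi (- i)"
      using powi_Suc[of "- i"] by simp
    ultimately show ?case
      using is_conj_mult[OF is_conj_swap[OF base]] by (simp only:)
  qed
qed

text \<open>Conjugates are computed through the relation \<open>is_conj\<close>, whose closure rules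
  do not mention the definite description. Uniqueness, which rests on the irrationality of
  \<open>\<theta>\<close>, then makes the description denote the computed value.\<close>

lemma galois_conj_eqI: "is_conj \<theta> \<alpha> \<beta> \<Longrightarrow> galois_conj \<theta> \<alpha> = \<beta>"
  unfolding galois_conj_def is_conj_def[symmetric] using is_conj_unique by blast

lemma is_conj_galois_conj:
  assumes "\<alpha> \<in> quad_field \<theta>"
  shows "is_conj \<theta> \<alpha> (galois_conj \<theta> \<alpha>)"
proof -
  have "\<exists>\<beta>. is_conj \<theta> \<alpha> \<beta>"
    using assms is_conjI unfolding quad_field_def by blast
  then show ?thesis
    using galois_conj_eqI by blast
qed

section \<open>The lowest exponent and the size of the conjugate\<close>

text \<open>
  The second inequality, for words that do not complete a forbidden word begun just below \<open>m\<close>,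
  is what makes the induction work.
\<close>

lemma greedy_conj_sum_less:
  assumes "greedy_digits a m M b"
  shows "(\<Sum>i=m..M. of_int (b i) * \<theta> powi (- i)) < \<theta> powi (1 - m)"
    and "\<not> (\<exists>i\<in>{m..M}. b i = a - 1 \<and> (\<forall>l\<in>{m..<i}. b l = a - 2)) \<Longrightarrow>
      (\<Sum>i=m..M. of_int (b i) * \<theta> powi (- i)) < \<theta> powi (1 - m) - \<theta> powi (- m)"
proof -
  define S where "S m = (\<Sum>i=m..M. of_int (b i) * \<theta> powi (- i))" for m
  \<comment> \<open>\<open>tight m\<close> says that a digit \<open>a - 1\<close> could be placed at
    position \<open>m - 1\<close> without completing a forbidden word.\<close>
  define tight where
    "tight m \<longleftrightarrow> \<not> (\<exists>i\<in>{m..M}. b i = a - 1 \<and> (\<forall>l\<in>{m..<i}. b l = a - 2))" for m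
  have "S m < \<theta> powi (1 - m) \<and> (tight m \<longrightarrow> S m < \<theta> powi (1 - m) - \<theta> powi (- m))"
    using assms
  \<comment> \<open>Induction on the number of digits, removing the lowest one; its weight
    \<open>P\<close> is the largest in the conjugate sum.\<close>
  proof (induction "nat (M + 1 - m)" arbitrary: m)
    case 0
    then have "S m = 0" by (simp add: S_def)
    moreover have "\<theta> powi (- m) < \<theta> powi (1 - m)"
      using theta_gt by (intro power_int_strict_increasing) auto
    moreover have "0 < \<theta> powi (- m)" using theta_gt by simp
    ultimately show ?case by linarith
  next
    case (Suc n)
    define P where "P = \<theta> powi (- m)"
    have P: "P > 0" using theta_gt by (simp add: P_def)
    have pow: "\<theta> powi (1 - m) = \<theta> * P" "\<theta> powi (1 - (m + 1)) = P"
      "\<theta> powi (- (m + 1)) = (of_int a - \<theta>) * P"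
      using theta_gt theta_inverse
      by (simp_all add: P_def power_int_diff power_int_minus power_int_add field_simps)
    have mM: "m \<le> M" using Suc.hyps by simp
    have "{m..M} = insert m {m+1..M}" using mM by auto
    then have S: "S m = of_int (b m) * P + S (m + 1)"
      by (simp add: S_def P_def)
    have gr: "greedy_digits a (m + 1) M b"
      using greedy_digits_mono[OF Suc.prems] by simp
    have IH: "S (m + 1) < P" "tight (m + 1) \<Longrightarrow> S (m + 1) < P - (of_int a - \<theta>) * P"
      using Suc.hyps(1)[OF _ gr] Suc.hyps(2) unfolding pow by auto
    have digit: "b m \<le> a - 1"
      using Suc.prems mM by (simp add: greedy_digits_def)
    have a_less: "of_int a < \<theta> + 1"
      using theta_inverse theta_gt inverse_less_1_iff[of \<theta>] by simp
    have le: "of_int (b m) * P \<le> of_int c * P" if "b m \<le> c" for c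
      using that P by simp
    have tight_next: "tight (m + 1)" if "b m = a - 1"
      unfolding tight_def
    proof
      assume "\<exists>i\<in>{m+1..M}. b i = a - 1 \<and> (\<forall>l\<in>{m+1..<i}. b l = a - 2)"
      then obtain i where "i \<in> {m+1..M}" "b i = a - 1" "\<forall>l\<in>{m+1..<i}. b l = a - 2"
        by blast
      then have "m \<le> m \<and> m < i \<and> i \<le> M \<and> b i = a - 1 \<and> b m = a - 1 \<and> (\<forall>l\<in>{m<..<i}. b l = a - 2)"
        using that by auto
      then show False
        using Suc.prems unfolding greedy_digits_def by blast
    qed
    \<comment> \<open>The digit \<open>a - 1\<close> leaves
      \<open>\<theta> * P - (a - 1) * P = P - (a - \<theta>) * P\<close>, exactly the stronger bound
      at \<open>m + 1\<close>. A smaller digit leaves more than \<open>P\<close>, because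
      \<open>a - 1 < \<theta>\<close>, and the weaker bound suffices.\<close>
    have "S m < \<theta> * P"
    proof (cases "b m = a - 1")
      case True
      then show ?thesis
        using IH(2)[OF tight_next[OF True]] unfolding S True by (simp add: algebra_simps)
    next
      case False
      then have "of_int (b m) * P \<le> of_int (a - 2) * P"
        using digit by (intro le) simp
      moreover have "of_int (a - 1) * P < \<theta> * P"
        using a_less P by simp
      ultimately show ?thesis
        using IH(1) S by (simp add: algebra_simps)
    qed
    \<comment> \<open>Tightness excludes the digit \<open>a - 1\<close>. The digit
      \<open>a - 2\<close> passes tightness on to \<open>m + 1\<close>, and the stronger bound there
      again fits exactly; a digit at most \<open>a - 3\<close> leaves more than
      \<open>P\<close>.\<close>
    moreover have "S m < \<theta> * P - P" if t: "tight m"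
    proof -
      have "b m \<noteq> a - 1"
        using t mM unfolding tight_def by auto
      then consider "b m = a - 2" | "b m \<le> a - 3"
        using digit by linarith
      then show ?thesis
      proof cases
        case 1
        have "tight (m + 1)"
          unfolding tight_def
        proof
          assume "\<exists>i\<in>{m+1..M}. b i = a - 1 \<and> (\<forall>l\<in>{m+1..<i}. b l = a - 2)"
          then obtain i where i: "i \<in> {m+1..M}" "b i = a - 1" "\<forall>l\<in>{m+1..<i}. b l = a - 2"
            by blast
          have "\<forall>l\<in>{m..<i}. b l = a - 2"
          proof
            fix l assume "l \<in> {m..<i}"
            then show "b l = a - 2" using i(3) 1 by (cases "l = m") auto
          qed
          moreover have "i \<in> {m..M}" using i(1) by auto
          ultimately show False
            using t i(2) unfolding tight_def by blast
        qed
        then show ?thesis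
          using IH(2) S 1 by (simp add: algebra_simps)
      next
        case 2
        then have "of_int (b m) * P \<le> of_int (a - 3) * P"
          by (rule le)
        moreover have "of_int (a - 1) * P < \<theta> * P"
          using a_less P by simp
        ultimately show ?thesis
          using IH(1) S by (simp add: algebra_simps)
      qed
    qed
    ultimately show ?case
      unfolding pow P_def[symmetric] by blast
  qed
  then show "(\<Sum>i=m..M. of_int (b i) * \<theta> powi (- i)) < \<theta> powi (1 - m)"
    and "\<not> (\<exists>i\<in>{m..M}. b i = a - 1 \<and> (\<forall>l\<in>{m..<i}. b l = a - 2)) \<Longrightarrow>
      (\<Sum>i=m..M. of_int (b i) * \<theta> powi (- i)) < \<theta> powi (1 - m) - \<theta> powi (- m)"
    unfolding S_def tight_def by auto
qed

text \<open>The conjugate is, up to sign, a sum of nonnegative terms. The term at \<open>m\<close>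
  alone gives the lower bound, and greediness gives the upper one.\<close>

lemma has_lowest_exponent_conj_bounds:
  assumes "has_lowest_exponent a \<theta> \<alpha> m"
  shows "\<theta> powi (- m) \<le> \<bar>galois_conj \<theta> \<alpha>\<bar>" "\<bar>galois_conj \<theta> \<alpha>\<bar> < \<theta> powi (1 - m)"
proof -
  obtain M b s where mM: "m \<le> M" and greedy: "greedy_digits a m M b" and bm: "b m \<noteq> 0"
    and s: "s \<in> {1, -1 :: real}" and \<alpha>: "\<alpha> = s * (\<Sum>i=m..M. of_int (b i) * \<theta> powi i)"
    using assms unfolding has_lowest_exponent_def by blast
  define S where "S = (\<Sum>i=m..M. of_int (b i) * \<theta> powi (- i))"
  have "is_conj \<theta> \<alpha> (s * S)"
    unfolding \<alpha> S_def using s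
    by (intro is_conj_mult is_conj_sum is_conj_powi is_conj_rat) auto
  then have conj: "galois_conj \<theta> \<alpha> = s * S"
    by (rule galois_conj_eqI)
  have digit: "b i \<ge> 0" if "i \<in> {m..M}" for i
    using greedy that unfolding greedy_digits_def by auto
  have nonneg: "of_int (b i) * \<theta> powi (- i) \<ge> 0" if "i \<in> {m..M}" for i
    using digit[OF that] theta_gt by simp
  have "b m \<ge> 1"
    using digit[of m] bm mM by simp
  then have "\<theta> powi (- m) \<le> of_int (b m) * \<theta> powi (- m)"
    using theta_gt by simp
  also have "\<dots> \<le> S"
    unfolding S_def using mM nonneg by (intro member_le_sum) auto
  finally have lower: "\<theta> powi (- m) \<le> S" .
  moreover have "0 < \<theta> powi (- m)" using theta_gt by simp
  ultimately have "\<bar>s * S\<bar> = S"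
    using s by auto
  then show "\<theta> powi (- m) \<le> \<bar>galois_conj \<theta> \<alpha>\<bar>" "\<bar>galois_conj \<theta> \<alpha>\<bar> < \<theta> powi (1 - m)"
    using lower greedy_conj_sum_less(1)[OF greedy] unfolding conj S_def by auto
qed

text \<open>The half-open intervals from \<open>\<theta> powi (- m)\<close> to
  \<open>\<theta> powi (1 - m)\<close> are disjoint for different \<open>m\<close>, so the conjugate
  determines \<open>m\<close> without any comparison of digits.\<close>

lemma has_lowest_exponent_unique:
  assumes "has_lowest_exponent a \<theta> \<alpha> m" "has_lowest_exponent a \<theta> \<alpha> n"
  shows "m = n"
proof -
  have "\<theta> powi (- m) < \<theta> powi (1 - n)" "\<theta> powi (- n) < \<theta> powi (1 - m)"
    using has_lowest_exponent_conj_bounds[OF assms(1)] has_lowest_exponent_conj_bounds[OF assms(2)]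
    by linarith+
  then have "- m < 1 - n" "- n < 1 - m"
    using power_int_less_cancel[OF theta_gt] by blast+
  then show ?thesis by simp
qed

section \<open>Existence of greedy expansions\<close>

lemma forbidden_word_sum:
  assumes "j \<le> i"
  shows "(\<Sum>l=j..i. of_int (a - 2) * \<theta> powi l)
    = \<theta> powi (i + 1) - \<theta> powi i - \<theta> powi j + \<theta> powi (j - 1)"
  using assms
\<comment> \<open>By \<open>powi_diff_1\<close>, \<open>(a - 2) * \<theta> powi l\<close> is the
  second difference \<open>\<theta> powi (l + 1) - 2 * \<theta> powi l + \<theta> powi (l -
  1)\<close>, so the sum telescopes.\<close>
proof (induction i rule: int_ge_induct)
  case base
  show ?case using powi_diff_1[of j] by (simp add: algebra_simps)
next
  case (step i)
  have "{j..i + 1} = insert (i + 1) {j..i}" using step by auto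
  then show ?case
    using step powi_diff_1[of "i + 1"] by (simp add: algebra_simps)
qed

text \<open>A sum of powers is encoded by the multiset of its exponents. \<open>W\<close> encodes
  the forbidden word from \<open>j\<close> to \<open>i\<close>, or the single digit \<open>a\<close>
  if \<open>i = j\<close>. As \<open>a \<ge> 3\<close>, it has more than two elements, so exchanging
  it for two powers shortens the sum.\<close>

lemma forbidden_word_mset:
  fixes W :: "int multiset"
  assumes "j \<le> i"
  defines "W \<equiv> repeat_mset (nat (a - 2)) (mset_set {j..i}) + {#i, j#}"
  shows "(\<Sum>l\<in>#W. \<theta> powi l) = (\<Sum>l\<in>#{#i + 1, j - 1#}. \<theta> powi l)" and "size W > 2"
proof -
  have "(\<Sum>l\<in>#repeat_mset n A. \<theta> powi l) = of_nat n * (\<Sum>l\<in>#A. \<theta> powi l)" for n A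
    by (induction n) (simp_all add: algebra_simps)
  moreover have "(\<Sum>l\<in>#mset_set {j..i}. of_int (a - 2) * \<theta> powi l) =
      \<theta> powi (i + 1) - \<theta> powi i - \<theta> powi j + \<theta> powi (j - 1)"
    using forbidden_word_sum[OF assms(1)] by (simp only: sum_unfold_sum_mset)
  ultimately show "(\<Sum>l\<in>#W. \<theta> powi l) = (\<Sum>l\<in>#{#i + 1, j - 1#}. \<theta> powi l)"
    using a_ge by (simp add: W_def sum_mset_distrib_left)
  show "size W > 2"
    using assms(1) a_ge by (simp add: W_def)
qed

lemma minimal_mset_greedy:
  fixes B :: "int multiset"
  assumes min: "\<And>C :: int multiset. (\<Sum>l\<in>#C. \<theta> powi l) = (\<Sum>l\<in>#B. \<theta> powi l) \<Longrightarrow> size B \<le> size C"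
  shows "greedy_digits a m M (\<lambda>i. int (count B i))"
proof -
  have no_word: False
    if ji: "j \<le> i" and sub: "repeat_mset (nat (a - 2)) (mset_set {j..i}) + {#i, j#} \<subseteq># B" for i j
  proof -
    define W where "W = repeat_mset (nat (a - 2)) (mset_set {j..i}) + {#i, j#}"
    obtain D where D: "B = W + D"
      using sub unfolding W_def by (auto simp: subset_mset.le_iff_add)
    have "(\<Sum>l\<in>#W. \<theta> powi l) = (\<Sum>l\<in>#{#i + 1, j - 1#}. \<theta> powi l)"
      using forbidden_word_mset(1)[OF ji] unfolding W_def .
    then have "size B \<le> size ({#i + 1, j - 1#} + D)"
      by (intro min) (simp add: D)
    then show False
      using forbidden_word_mset(2)[OF ji] unfolding D W_def by simp
  qed
  \<comment> \<open>The case \<open>i = j\<close> of the exchange: a digit at least \<open>a\<close>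
    would contain \<open>a\<close> copies of one exponent.\<close>
  have "count B i \<le> nat (a - 1)" for i
  proof (rule ccontr)
    assume "\<not> ?thesis"
    then have "repeat_mset (nat (a - 2)) (mset_set {i..i}) + {#i, i#} \<subseteq># B"
      using a_ge by (intro mset_subset_eqI) auto
    then show False using no_word by blast
  qed
  then have "int (count B i) \<in> {0..a - 1}" for i
    using a_ge by (simp add: le_nat_iff)
  moreover have False
    if ji: "j < i" and ends: "int (count B i) = a - 1" "int (count B j) = a - 1"
      and mid: "\<forall>l\<in>{j<..<i}. int (count B l) = a - 2" for i j
  proof -
    have "repeat_mset (nat (a - 2)) (mset_set {j..i}) + {#i, j#} \<subseteq># B"
    proof (rule mset_subset_eqI)
      fix l
      consider "l = i" | "l = j" | "l \<notin> {j..i}"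
        | "l \<in> {j<..<i}" "int (count B l) = a - 2"
        using mid by force
      then show "count (repeat_mset (nat (a - 2)) (mset_set {j..i}) + {#i, j#}) l \<le> count B l"
        using ji ends a_ge by cases (auto simp: count_mset_set')
    qed
    then show False
      by (rule no_word[OF less_imp_le[OF ji]])
  qed
  ultimately show ?thesis
    unfolding greedy_digits_def by blast
qed

text \<open>Choosing a representation of least size replaces a carrying procedure and its
  termination argument. The least exponent that occurs has a nonzero digit, so it is the lowest
  exponent.\<close>

lemma has_lowest_exponent_mset:
  fixes B :: "int multiset"
  assumes "\<alpha> = (\<Sum>l\<in>#B. \<theta> powi l)" "\<alpha> > 0"
  shows "\<exists>m. has_lowest_exponent a \<theta> \<alpha> m"
proof -
  define rep where "rep C \<longleftrightarrow> \<alpha> = (\<Sum>l\<in>#C. \<theta> powi l)" for C :: "int multiset"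
  have "rep B" using assms(1) by (simp add: rep_def)
  then obtain C where C: "rep C" and min: "\<And>D. rep D \<Longrightarrow> size C \<le> size D"
    using ex_has_least_nat[of rep B size] by blast
  have C_ne: "set_mset C \<noteq> {}"
    using C assms(2) by (auto simp: rep_def)
  define m M where "m = Min (set_mset C)" and "M = Max (set_mset C)"
  have "m \<in># C"
    unfolding m_def using C_ne by simp
  then have mM: "m \<le> M" and Cm: "int (count C m) \<noteq> 0"
    unfolding M_def by simp_all
  have sub: "set_mset C \<subseteq> {m..M}"
    unfolding m_def M_def using C_ne by auto
  have "\<alpha> = (\<Sum>l=m..M. real (count C l) * \<theta> powi l)"
    using C sum_mset_eq_sum_count[OF _ sub] unfolding rep_def by simp
  then have "\<alpha> = 1 * (\<Sum>l=m..M. of_int (int (count C l)) * \<theta> powi l)"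
    by simp
  moreover have "greedy_digits a m M (\<lambda>i. int (count C i))"
    using C min unfolding rep_def by (intro minimal_mset_greedy) auto
  ultimately show ?thesis
    unfolding has_lowest_exponent_def using mM Cm by blast
qed

text \<open>Two consecutive powers form an integral basis of \<open>Z_theta\<close>, since the
  recurrence lets one step the pair up or down. The same integers \<open>u\<close>, \<open>v\<close>
  must serve the conjugate, whose powers obey the same recurrence.\<close>

lemma Z_theta_basis_powi:
  fixes x y k :: int
  shows "\<exists>u v :: int. of_int x + of_int y * \<theta> = of_int u * \<theta> powi k + of_int v * \<theta> powi (k + 1)
    \<and> of_int x + of_int y * inverse \<theta> = of_int u * \<theta> powi (- k) + of_int v * \<theta> powi (- (k + 1))"
proof (induction k rule: int_induct[where k = 0])
  case base
  show ?case
    by (rule exI[of _ x], rule exI[of _ y], simp add: power_int_minus)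
next
  case (step1 k)
  then obtain u v where
    *: "of_int x + of_int y * \<theta> = of_int u * \<theta> powi k + of_int v * \<theta> powi (k + 1)"
      "of_int x + of_int y * inverse \<theta> = of_int u * \<theta> powi (- k) + of_int v * \<theta> powi (- (k + 1))"
    by blast
  have p1: "\<theta> powi k = of_int a * \<theta> powi (k + 1) - \<theta> powi (k + 1 + 1)"
    using powi_diff_1[of "k + 1"] by simp
  have p2: "\<theta> powi (- k) = of_int a * \<theta> powi (- (k + 1)) - \<theta> powi (- (k + 1 + 1))"
    using powi_diff_1[of "- (k + 1)"] by simp
  show ?case
    unfolding * p1 p2 by (rule exI[of _ "v + a * u"], rule exI[of _ "- u"], simp add: algebra_simps)
next
  case (step2 k)
  then obtain u v where
    *: "of_int x + of_int y * \<theta> = of_int u * \<theta> powi k + of_int v * \<theta> powi (k + 1)"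
      "of_int x + of_int y * inverse \<theta> = of_int u * \<theta> powi (- k) + of_int v * \<theta> powi (- (k + 1))"
    by blast
  have p1: "\<theta> powi (k + 1) = of_int a * \<theta> powi k - \<theta> powi (k - 1)"
    using powi_diff_1[of k] by simp
  have p2: "\<theta> powi (- (k + 1)) = of_int a * \<theta> powi (- k) - \<theta> powi (- (k - 1))"
    using powi_diff_1[of "- k"] by simp
  show ?case
    unfolding * p1 p2 by (rule exI[of _ "- v"], rule exI[of _ "u + a * v"], simp add: algebra_simps)
qed

text \<open>The ratio of \<open>\<theta> powi k\<close> to its conjugate is
  \<open>(\<theta>\<^sup>2) powi k\<close>. Locating the ratio of the element to its conjugate
  between two such values selects the cone containing it, where both integer coordinates are
  nonnegative.\<close>

lemma totally_positive_mset:
  fixes x y :: int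
  assumes pos: "of_int x + of_int y * \<theta> > 0" "of_int x + of_int y * inverse \<theta> > 0"
  shows "\<exists>B :: int multiset. of_int x + of_int y * \<theta> = (\<Sum>l\<in>#B. \<theta> powi l)"
proof -
  define \<alpha> \<beta> where "\<alpha> = of_int x + of_int y * \<theta>" and "\<beta> = of_int x + of_int y * inverse \<theta>"
  have pos': "\<alpha> > 0" "\<beta> > 0" using pos by (simp_all add: \<alpha>_def \<beta>_def)
  have "\<theta>\<^sup>2 > 1" using theta_gt by simp
  then obtain k where k: "(\<theta>\<^sup>2) powi k \<le> \<alpha> / \<beta>" "\<alpha> / \<beta> < (\<theta>\<^sup>2) powi (k + 1)"
    using int_power_bracket[of "\<theta>\<^sup>2" "\<alpha> / \<beta>"] pos' by auto
  obtain u v where \<alpha>: "\<alpha> = of_int u * \<theta> powi k + of_int v * \<theta> powi (k + 1)"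
    and \<beta>: "\<beta> = of_int u * \<theta> powi (- k) + of_int v * \<theta> powi (- (k + 1))"
    using Z_theta_basis_powi[of x y k] unfolding \<alpha>_def \<beta>_def by blast
  define P where "P = \<theta> powi k"
  have P: "P > 0" using theta_gt by (simp add: P_def)
  have \<alpha>': "\<alpha> = P * (of_int u + of_int v * \<theta>)"
    unfolding \<alpha> powi_Suc P_def by (simp add: algebra_simps)
  have \<beta>': "P * \<beta> = of_int u + of_int v * inverse \<theta>"
  proof -
    have "\<beta> = of_int u * inverse P + of_int v * (inverse \<theta> * inverse P)"
      unfolding \<beta> P_def by (simp only: power_int_minus powi_Suc inverse_mult_distrib)
    then show ?thesis using P by (simp add: field_simps)
  qed
  have P2: "(\<theta>\<^sup>2) powi k = P * P"
    by (simp add: P_def power2_eq_square power_int_mult_distrib)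
  then have P2': "(\<theta>\<^sup>2) powi (k + 1) = \<theta>\<^sup>2 * (P * P)"
    using theta_gt by (simp add: power_int_add)
  \<comment> \<open>The lower bound on the ratio cancels \<open>u\<close> and fixes the sign of
    \<open>v\<close>.\<close>
  have "P * (P * \<beta>) \<le> \<alpha>"
    using k(1) pos' unfolding P2 by (simp add: field_simps)
  then have "of_int u + of_int v * inverse \<theta> \<le> of_int u + of_int v * \<theta>"
    unfolding \<beta>' \<alpha>' using P by simp
  then have "0 \<le> of_int v * (\<theta> - inverse \<theta>)"
    by (simp add: algebra_simps)
  moreover have "inverse \<theta> < \<theta>"
    using theta_gt by (meson inverse_less_1_iff less_trans)
  ultimately have v: "v \<ge> 0"
    by (simp add: zero_le_mult_iff)
  \<comment> \<open>The upper bound cancels \<open>v\<close> and fixes the sign of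
    \<open>u\<close>.\<close>
  have "\<alpha> < \<theta>\<^sup>2 * (P * (P * \<beta>))"
    using k(2) pos' unfolding P2' by (simp add: field_simps)
  then have "P * (of_int u + of_int v * \<theta>) < P * (\<theta>\<^sup>2 * (of_int u + of_int v * inverse \<theta>))"
    unfolding \<beta>' by (simp add: \<alpha>' algebra_simps)
  then have "of_int u + of_int v * \<theta> < \<theta>\<^sup>2 * (of_int u + of_int v * inverse \<theta>)"
    using P by simp
  also have "\<dots> = \<theta>\<^sup>2 * of_int u + of_int v * \<theta>"
    using theta_gt by (simp add: field_simps power2_eq_square)
  finally have "0 < of_int u * (\<theta>\<^sup>2 - 1)"
    by (simp add: algebra_simps)
  then have u: "u > 0"
    using \<open>\<theta>\<^sup>2 > 1\<close> by (simp add: zero_less_mult_iff)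
  have "\<alpha> = (\<Sum>l\<in>#replicate_mset (nat u) k + replicate_mset (nat v) (k + 1). \<theta> powi l)"
    using u v \<alpha> by (simp add: sum_mset_replicate_mset)
  then show ?thesis
    unfolding \<alpha>_def by blast
qed

lemma has_lowest_exponent_uminus:
  assumes "has_lowest_exponent a \<theta> \<alpha> m"
  shows "has_lowest_exponent a \<theta> (- \<alpha>) m"
proof -
  obtain M b s where "m \<le> M" "greedy_digits a m M b" "b m \<noteq> 0" "s \<in> {1, -1 :: real}"
    and "\<alpha> = s * (\<Sum>i=m..M. of_int (b i) * \<theta> powi i)"
    using assms unfolding has_lowest_exponent_def by blast
  moreover from this have "- s \<in> {1, -1}" "- \<alpha> = - s * (\<Sum>i=m..M. of_int (b i) * \<theta> powi i)"
    by auto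
  ultimately show ?thesis
    unfolding has_lowest_exponent_def by blast
qed

lemma has_lowest_exponent_exists:
  assumes "\<alpha> \<in> Z_theta \<theta>" "is_conj \<theta> \<alpha> \<beta>" "\<alpha> * \<beta> > 0"
  shows "\<exists>m. has_lowest_exponent a \<theta> \<alpha> m"
proof -
  obtain x y :: int where \<alpha>: "\<alpha> = of_int x + of_int y * \<theta>"
    using assms(1) unfolding Z_theta_def by blast
  then have \<beta>: "\<beta> = of_int x + of_int y * inverse \<theta>"
    using is_conj_unique[OF assms(2)] is_conjI[of "of_int x" "of_int y" \<theta>] by simp
  show ?thesis
  proof (cases "\<alpha> > 0")
    case True
    then have "\<beta> > 0" using assms(3) by (simp add: zero_less_mult_iff)
    then obtain B :: "int multiset" where "\<alpha> = (\<Sum>l\<in>#B. \<theta> powi l)"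
      using totally_positive_mset[of x y] True unfolding \<alpha> \<beta> by blast
    then show ?thesis using has_lowest_exponent_mset True by blast
  next
    case False
    then have neg: "\<alpha> < 0" "\<beta> < 0" using assms(3) by (auto simp: zero_less_mult_iff)
    then obtain B :: "int multiset" where "- \<alpha> = (\<Sum>l\<in>#B. \<theta> powi l)"
      using totally_positive_mset[of "- x" "- y"] unfolding \<alpha> \<beta> by auto
    then have "\<exists>m. has_lowest_exponent a \<theta> (- \<alpha>) m"
      using neg by (intro has_lowest_exponent_mset) auto
    then show ?thesis using has_lowest_exponent_uminus by fastforce
  qed
qed

text \<open>Existence and uniqueness of the lowest exponent \<open>m\<close> evaluate the definite
  description, with \<open>k = - m\<close>. The later estimates use only this bracket and no
  digits.\<close>

lemma abs_theta0_bracket: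
  assumes "\<alpha> \<in> Z_theta \<theta>" "is_conj \<theta> \<alpha> \<beta>" "\<alpha> * \<beta> > 0"
  obtains k where "abs_theta0 a \<theta> \<alpha> = \<theta> powi k" "\<theta> powi k \<le> \<bar>\<beta>\<bar>" "\<bar>\<beta>\<bar> < \<theta> powi (k + 1)"
proof -
  obtain m where m: "has_lowest_exponent a \<theta> \<alpha> m"
    using has_lowest_exponent_exists[OF assms] by blast
  then have "(THE n. has_lowest_exponent a \<theta> \<alpha> n) = m"
    using has_lowest_exponent_unique by blast
  then have "abs_theta0 a \<theta> \<alpha> = \<theta> powi (- m)"
    using assms(3) by (auto simp: abs_theta0_def)
  then show ?thesis
    using has_lowest_exponent_conj_bounds[OF m] galois_conj_eqI[OF assms(2)] that[of "- m"] by auto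
qed

section \<open>The absolute value on the two sign classes\<close>

lemma zero_in_quad_field: "0 \<in> quad_field \<theta>"
  unfolding quad_field_def by force

lemma O_K0_quad_field: "\<alpha> \<in> O_K0 \<theta> \<Longrightarrow> \<alpha> \<in> quad_field \<theta>"
  using zero_in_quad_field by (auto simp: O_K0_def O_K_def)

lemma O_K1_quad_field: "\<alpha> \<in> O_K1 \<theta> \<Longrightarrow> \<alpha> \<in> quad_field \<theta>"
  using zero_in_quad_field by (auto simp: O_K1_def O_K_def)

lemma O_K0_norm_pos:
  assumes "\<alpha> \<in> O_K0 \<theta>" "\<alpha> \<noteq> 0"
  shows "\<alpha> * galois_conj \<theta> \<alpha> > 0"
  using assms by (auto simp: O_K0_def sgn_if zero_less_mult_iff split: if_splits)

lemma O_K1_norm_neg: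
  assumes "\<alpha> \<in> O_K1 \<theta>" "\<alpha> \<noteq> 0"
  shows "\<alpha> * galois_conj \<theta> \<alpha> < 0"
proof -
  \<comment> \<open>Different signs alone would still allow a vanishing conjugate, and then the norm
    would be zero rather than negative.\<close>
  have "galois_conj \<theta> \<alpha> \<noteq> 0"
    using is_conj_0_iff[OF is_conj_galois_conj[OF O_K1_quad_field]] assms by blast
  then show ?thesis
    using assms by (auto simp: O_K1_def sgn_if mult_less_0_iff split: if_splits)
qed

lemma O_K0_nonzero_not_O_K1: "\<alpha> \<in> O_K0 \<theta> \<Longrightarrow> \<alpha> \<noteq> 0 \<Longrightarrow> \<alpha> \<notin> O_K1 \<theta>"
  by (auto simp: O_K0_def O_K1_def)

lemma galois_conj_mult:
  assumes "\<alpha> \<in> quad_field \<theta>" "\<beta> \<in> quad_field \<theta>"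
  shows "galois_conj \<theta> (\<alpha> * \<beta>) = galois_conj \<theta> \<alpha> * galois_conj \<theta> \<beta>"
  using assms by (intro galois_conj_eqI is_conj_mult is_conj_galois_conj)

lemma is_conj_theta_minus_1: "is_conj \<theta> (\<theta> - 1) (inverse \<theta> - 1)"
  using is_conjI[of "-1" 1 \<theta>] by simp

lemma abs_theta_O_K0_bracket:
  assumes "\<alpha> \<in> O_K0 \<theta>" "\<alpha> \<in> abs_theta_domain \<theta>" "\<alpha> \<noteq> 0"
  obtains k where "abs_theta a \<theta> \<alpha> = \<theta> powi k"
    "\<theta> powi k \<le> \<bar>galois_conj \<theta> \<alpha>\<bar>" "\<bar>galois_conj \<theta> \<alpha>\<bar> < \<theta> powi (k + 1)"
proof -
  have "\<alpha> \<in> Z_theta \<theta>"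
    using assms O_K0_nonzero_not_O_K1 by (auto simp: abs_theta_domain_def)
  then obtain k where "abs_theta0 a \<theta> \<alpha> = \<theta> powi k"
    "\<theta> powi k \<le> \<bar>galois_conj \<theta> \<alpha>\<bar>" "\<bar>galois_conj \<theta> \<alpha>\<bar> < \<theta> powi (k + 1)"
    using abs_theta0_bracket is_conj_galois_conj[OF O_K0_quad_field[OF assms(1)]]
      O_K0_norm_pos[OF assms(1,3)] by blast
  then show ?thesis
    using assms(1) that[of k] by (simp add: abs_theta_def)
qed

text \<open>The factor \<open>\<theta> - 1\<close> has negative norm, so multiplying by it makes the
  norm positive. The size of its conjugate is \<open>1 - inverse \<theta>\<close>, which appears in
  the bracket.\<close>

lemma abs_theta_O_K1_bracket:
  assumes "\<alpha> \<in> O_K1 \<theta>" "\<alpha> \<in> abs_theta_domain \<theta>" "\<alpha> \<noteq> 0"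
  obtains k where "abs_theta a \<theta> \<alpha> = \<theta> powi k"
    "\<theta> powi k \<le> (1 - inverse \<theta>) * \<bar>galois_conj \<theta> \<alpha>\<bar>"
    "(1 - inverse \<theta>) * \<bar>galois_conj \<theta> \<alpha>\<bar> < \<theta> powi (k + 1)"
proof -
  let ?\<beta> = "(inverse \<theta> - 1) * galois_conj \<theta> \<alpha>"
  have not0: "\<alpha> \<notin> O_K0 \<theta>"
    using assms O_K0_nonzero_not_O_K1 by blast
  then have Z: "(\<theta> - 1) * \<alpha> \<in> Z_theta \<theta>"
    using assms(2) by (auto simp: abs_theta_domain_def)
  have conj: "is_conj \<theta> ((\<theta> - 1) * \<alpha>) ?\<beta>"
    using assms(1) by (intro is_conj_mult is_conj_theta_minus_1 is_conj_galois_conj O_K1_quad_field)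
  have inv: "inverse \<theta> < 1"
    using theta_gt by (simp add: inverse_less_1_iff)
  then have "(\<theta> - 1) * (inverse \<theta> - 1) < 0"
    using theta_gt by (simp add: mult_less_0_iff)
  then have "0 < ((\<theta> - 1) * (inverse \<theta> - 1)) * (\<alpha> * galois_conj \<theta> \<alpha>)"
    using O_K1_norm_neg[OF assms(1,3)] by (rule mult_neg_neg)
  then have "((\<theta> - 1) * \<alpha>) * ?\<beta> > 0"
    by (simp only: ac_simps)
  moreover have "\<bar>?\<beta>\<bar> = (1 - inverse \<theta>) * \<bar>galois_conj \<theta> \<alpha>\<bar>"
    using inv by (simp add: abs_mult)
  ultimately obtain k where "abs_theta0 a \<theta> ((\<theta> - 1) * \<alpha>) = \<theta> powi k"
    "\<theta> powi k \<le> (1 - inverse \<theta>) * \<bar>galois_conj \<theta> \<alpha>\<bar>"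
    "(1 - inverse \<theta>) * \<bar>galois_conj \<theta> \<alpha>\<bar> < \<theta> powi (k + 1)"
    using abs_theta0_bracket[OF Z conj] by metis
  then show ?thesis
    using not0 that[of k] by (simp add: abs_theta_def)
qed

section \<open>Estimates for products\<close>

text \<open>
  The slack \<open>1 \<le> c\<close>, \<open>c \<le> \<theta> powi d\<close> accounts for the factor \<open>1 / |T'|\<^sup>2\<close> that appears when both
  factors lie in \<open>O_K1\<close>.
\<close>

lemma bracket_mult:
  assumes x: "\<theta> powi k \<le> x" "x < \<theta> powi (k + 1)" and y: "\<theta> powi l \<le> y" "y < \<theta> powi (l + 1)"
    and z: "\<theta> powi n \<le> c * (x * y)" "c * (x * y) < \<theta> powi (n + 1)"
    and c: "1 \<le> c" "c \<le> \<theta> powi d"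
  shows "\<theta> powi k * \<theta> powi l \<le> \<theta> powi n \<and> \<theta> powi n \<le> \<theta> powi (d + 1) * (\<theta> powi k * \<theta> powi l)"
proof -
  have pos: "\<theta> powi i > 0" for i using theta_gt by simp
  have add: "\<theta> powi (i + j) = \<theta> powi i * \<theta> powi j" for i j
    using theta_gt by (simp add: power_int_add)
  have x0: "x > 0" and y0: "y > 0"
    using x(1) y(1) pos[of k] pos[of l] by linarith+
  have "\<theta> powi (k + l) \<le> x * y"
    unfolding add using x y0 y(1) pos[of l] x0 by (intro mult_mono) auto
  also have "\<dots> \<le> c * (x * y)"
    using c(1) x0 y0 by simp
  also have "\<dots> < \<theta> powi (n + 1)" by fact
  finally have "k + l < n + 1"
    by (rule power_int_less_cancel[OF theta_gt])
  have "\<theta> powi n \<le> c * (x * y)" by fact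
  also have "\<dots> \<le> \<theta> powi d * (x * y)"
    using c(2) x0 y0 by (intro mult_right_mono) auto
  also have "\<dots> < \<theta> powi d * (\<theta> powi (k + 1) * \<theta> powi (l + 1))"
    using x y x0 y0 pos by (intro mult_strict_left_mono mult_strict_mono) auto
  also have "\<dots> = \<theta> powi (d + (k + 1 + (l + 1)))"
    by (simp only: add)
  finally have "n < d + (k + 1 + (l + 1))"
    by (rule power_int_less_cancel[OF theta_gt])
  \<comment> \<open>Integrality sharpens the strict inequalities to \<open>k + l \<le> n\<close> and
    \<open>n \<le> d + 1 + (k + l)\<close>; this is the source of the extra factor
    \<open>\<theta>\<close>.\<close>
  have "\<theta> powi (k + l) \<le> \<theta> powi n" "\<theta> powi n \<le> \<theta> powi (d + 1 + (k + l))"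
    using \<open>k + l < n + 1\<close> \<open>n < d + (k + 1 + (l + 1))\<close> theta_gt
    by (auto intro!: power_int_increasing)
  then show ?thesis
    by (simp only: add)
qed

lemma abs_theta_0: "abs_theta a \<theta> 0 = 0"
  by (simp add: abs_theta_def abs_theta0_def)

lemma abs_theta_mult_O_K0_O_K0:
  assumes "f \<in> O_K0 \<theta>" "g \<in> O_K0 \<theta>"
    and dom: "f \<in> abs_theta_domain \<theta>" "g \<in> abs_theta_domain \<theta>" "f * g \<in> abs_theta_domain \<theta>"
  shows "abs_theta a \<theta> f * abs_theta a \<theta> g \<le> abs_theta a \<theta> (f * g) \<and>
    abs_theta a \<theta> (f * g) \<le> \<theta> * (abs_theta a \<theta> f * abs_theta a \<theta> g)"
proof (cases "f = 0 \<or> g = 0")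
  case True
  then show ?thesis by (auto simp: abs_theta_0)
next
  case False
  then have nz: "f \<noteq> 0" "g \<noteq> 0" "f * g \<noteq> 0" by auto
  have conj: "galois_conj \<theta> (f * g) = galois_conj \<theta> f * galois_conj \<theta> g"
    using assms(1,2) by (intro galois_conj_mult O_K0_quad_field)
  have "0 < (f * galois_conj \<theta> f) * (g * galois_conj \<theta> g)"
    using O_K0_norm_pos assms(1,2) nz by simp
  also have "\<dots> = (f * g) * galois_conj \<theta> (f * g)"
    by (simp only: conj ac_simps)
  \<comment> \<open>Positive norm excludes \<open>O_K1\<close>, so the domain hypothesis on the
    product leaves only \<open>O_K0\<close>.\<close>
  finally have "f * g \<notin> O_K1 \<theta>"
    using O_K1_norm_neg[OF _ nz(3)] by force
  then have fg: "f * g \<in> O_K0 \<theta>"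
    using dom(3) by (auto simp: abs_theta_domain_def)
  have xy: "\<bar>galois_conj \<theta> (f * g)\<bar> = 1 * (\<bar>galois_conj \<theta> f\<bar> * \<bar>galois_conj \<theta> g\<bar>)"
    by (simp add: conj abs_mult)
  obtain k where k: "abs_theta a \<theta> f = \<theta> powi k"
    "\<theta> powi k \<le> \<bar>galois_conj \<theta> f\<bar>" "\<bar>galois_conj \<theta> f\<bar> < \<theta> powi (k + 1)"
    using abs_theta_O_K0_bracket[OF assms(1) dom(1) nz(1)] by blast
  obtain l where l: "abs_theta a \<theta> g = \<theta> powi l"
    "\<theta> powi l \<le> \<bar>galois_conj \<theta> g\<bar>" "\<bar>galois_conj \<theta> g\<bar> < \<theta> powi (l + 1)"
    using abs_theta_O_K0_bracket[OF assms(2) dom(2) nz(2)] by blast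
  obtain n where n: "abs_theta a \<theta> (f * g) = \<theta> powi n"
    "\<theta> powi n \<le> 1 * (\<bar>galois_conj \<theta> f\<bar> * \<bar>galois_conj \<theta> g\<bar>)"
    "1 * (\<bar>galois_conj \<theta> f\<bar> * \<bar>galois_conj \<theta> g\<bar>) < \<theta> powi (n + 1)"
    using abs_theta_O_K0_bracket[OF fg dom(3) nz(3)] unfolding xy by blast
  show ?thesis
    using bracket_mult[OF k(2,3) l(2,3) n(2,3), of 0] unfolding k(1) l(1) n(1) by simp
qed

text \<open>Each factor is measured with a factor \<open>t = 1 - inverse \<theta>\<close>, but the
  product lies in \<open>O_K0\<close> and is measured without it. Hence \<open>bracket_mult\<close>
  is applied with \<open>c = 1 / t\<^sup>2\<close> and \<open>d = 1\<close>.\<close>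

lemma abs_theta_mult_O_K1_O_K1:
  assumes "f \<in> O_K1 \<theta>" "g \<in> O_K1 \<theta>"
    and dom: "f \<in> abs_theta_domain \<theta>" "g \<in> abs_theta_domain \<theta>" "f * g \<in> abs_theta_domain \<theta>"
  shows "abs_theta a \<theta> f * abs_theta a \<theta> g \<le> abs_theta a \<theta> (f * g) \<and>
    abs_theta a \<theta> (f * g) \<le> \<theta>\<^sup>2 * (abs_theta a \<theta> f * abs_theta a \<theta> g)"
proof (cases "f = 0 \<or> g = 0")
  case True
  then show ?thesis by (auto simp: abs_theta_0)
next
  case False
  then have nz: "f \<noteq> 0" "g \<noteq> 0" "f * g \<noteq> 0" by auto
  have conj: "galois_conj \<theta> (f * g) = galois_conj \<theta> f * galois_conj \<theta> g"
    using assms(1,2) by (intro galois_conj_mult O_K1_quad_field)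
  have "0 < (f * galois_conj \<theta> f) * (g * galois_conj \<theta> g)"
    using O_K1_norm_neg assms(1,2) nz by (intro mult_neg_neg) auto
  also have "\<dots> = (f * g) * galois_conj \<theta> (f * g)"
    by (simp only: conj ac_simps)
  finally have "f * g \<notin> O_K1 \<theta>"
    using O_K1_norm_neg[OF _ nz(3)] by force
  then have fg: "f * g \<in> O_K0 \<theta>"
    using dom(3) by (auto simp: abs_theta_domain_def)
  define t where "t = 1 - inverse \<theta>"
  have t: "0 < t" "t \<le> 1"
    using theta_gt by (simp_all add: t_def inverse_less_1_iff)
  have "t\<^sup>2 \<le> 1"
    using t by (simp add: power_le_one)
  \<comment> \<open>Since \<open>(\<theta> * t)\<^sup>2 = (\<theta> - 1)\<^sup>2 = (a - 2) *
    \<theta>\<close>, the correction \<open>1 / t\<^sup>2\<close> equals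
    \<open>\<theta> / (a - 2)\<close>; the bound \<open>a \<ge> 3\<close> keeps it at most
    \<open>\<theta>\<close>.\<close>
  have "1 * \<theta> \<le> of_int (a - 2) * \<theta>"
    using a_ge theta_gt by (intro mult_right_mono) auto
  also have "\<dots> = (\<theta> - 1)\<^sup>2"
    using theta_sq by (simp add: power2_eq_square algebra_simps)
  finally have "\<theta> \<le> (\<theta> - 1)\<^sup>2" by simp
  moreover have "\<theta> * t = \<theta> - 1"
    using theta_gt by (simp add: t_def algebra_simps)
  ultimately have "\<theta> \<le> (\<theta> * t)\<^sup>2"
    by simp
  then have "1 / t\<^sup>2 \<le> \<theta>"
    using theta_gt t by (simp add: field_simps power2_eq_square)
  have "1 / t\<^sup>2 \<ge> 1"
    using \<open>t\<^sup>2 \<le> 1\<close> t by simp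
  define x y where "x = t * \<bar>galois_conj \<theta> f\<bar>" and "y = t * \<bar>galois_conj \<theta> g\<bar>"
  have xy: "\<bar>galois_conj \<theta> (f * g)\<bar> = 1 / t\<^sup>2 * (x * y)"
    using t by (simp add: conj abs_mult x_def y_def power2_eq_square)
  obtain k where k: "abs_theta a \<theta> f = \<theta> powi k" "\<theta> powi k \<le> x" "x < \<theta> powi (k + 1)"
    using abs_theta_O_K1_bracket[OF assms(1) dom(1) nz(1)] unfolding x_def t_def by blast
  obtain l where l: "abs_theta a \<theta> g = \<theta> powi l" "\<theta> powi l \<le> y" "y < \<theta> powi (l + 1)"
    using abs_theta_O_K1_bracket[OF assms(2) dom(2) nz(2)] unfolding y_def t_def by blast
  obtain n where n: "abs_theta a \<theta> (f * g) = \<theta> powi n"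
    "\<theta> powi n \<le> 1 / t\<^sup>2 * (x * y)" "1 / t\<^sup>2 * (x * y) < \<theta> powi (n + 1)"
    using abs_theta_O_K0_bracket[OF fg dom(3) nz(3)] unfolding xy by blast
  show ?thesis
    using bracket_mult[OF k(2,3) l(2,3) n(2,3), of 1] \<open>1 / t\<^sup>2 \<ge> 1\<close> \<open>1 / t\<^sup>2 \<le> \<theta>\<close>
    unfolding k(1) l(1) n(1) by simp
qed

text \<open>The product has negative norm, so it carries the same factor
  \<open>1 - inverse \<theta>\<close> as \<open>g\<close>. The two cancel, and \<open>c = 1\<close>,
  \<open>d = 0\<close> suffice.\<close>

lemma abs_theta_mult_O_K0_O_K1:
  assumes "f \<in> O_K0 \<theta>" "g \<in> O_K1 \<theta>"
    and dom: "f \<in> abs_theta_domain \<theta>" "g \<in> abs_theta_domain \<theta>" "f * g \<in> abs_theta_domain \<theta>"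
  shows "abs_theta a \<theta> f * abs_theta a \<theta> g \<le> abs_theta a \<theta> (f * g) \<and>
    abs_theta a \<theta> (f * g) \<le> \<theta> * (abs_theta a \<theta> f * abs_theta a \<theta> g)"
proof (cases "f = 0 \<or> g = 0")
  case True
  then show ?thesis by (auto simp: abs_theta_0)
next
  case False
  then have nz: "f \<noteq> 0" "g \<noteq> 0" "f * g \<noteq> 0" by auto
  have conj: "galois_conj \<theta> (f * g) = galois_conj \<theta> f * galois_conj \<theta> g"
    using assms(1,2) by (intro galois_conj_mult O_K0_quad_field O_K1_quad_field)
  have "(f * g) * galois_conj \<theta> (f * g) = (f * galois_conj \<theta> f) * (g * galois_conj \<theta> g)"
    by (simp only: conj ac_simps)
  also have "\<dots> < 0"
    using O_K0_norm_pos[OF assms(1) nz(1)] O_K1_norm_neg[OF assms(2) nz(2)] by (rule mult_pos_neg)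
  finally have "f * g \<notin> O_K0 \<theta>"
    using O_K0_norm_pos[OF _ nz(3)] by force
  then have fg: "f * g \<in> O_K1 \<theta>"
    using dom(3) by (auto simp: abs_theta_domain_def)
  define x y where "x = \<bar>galois_conj \<theta> f\<bar>" and "y = (1 - inverse \<theta>) * \<bar>galois_conj \<theta> g\<bar>"
  have xy: "(1 - inverse \<theta>) * \<bar>galois_conj \<theta> (f * g)\<bar> = 1 * (x * y)"
    by (simp add: conj abs_mult x_def y_def)
  obtain k where k: "abs_theta a \<theta> f = \<theta> powi k" "\<theta> powi k \<le> x" "x < \<theta> powi (k + 1)"
    using abs_theta_O_K0_bracket[OF assms(1) dom(1) nz(1)] unfolding x_def by blast
  obtain l where l: "abs_theta a \<theta> g = \<theta> powi l" "\<theta> powi l \<le> y" "y < \<theta> powi (l + 1)"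
    using abs_theta_O_K1_bracket[OF assms(2) dom(2) nz(2)] unfolding y_def by blast
  obtain n where n: "abs_theta a \<theta> (f * g) = \<theta> powi n"
    "\<theta> powi n \<le> 1 * (x * y)" "1 * (x * y) < \<theta> powi (n + 1)"
    using abs_theta_O_K1_bracket[OF fg dom(3) nz(3)] unfolding xy by blast
  show ?thesis
    using bracket_mult[OF k(2,3) l(2,3) n(2,3), of 0] unfolding k(1) l(1) n(1) by simp
qed

end

theorem theorem7:
  fixes a :: int and \<theta> f g :: real
  assumes "a \<ge> 3" and "\<theta> > 1" and "\<theta>\<^sup>2 = of_int a * \<theta> - 1"
    and "f \<in> O_K \<theta>" and "g \<in> O_K \<theta>"
    and "f \<in> abs_theta_domain \<theta>" and "g \<in> abs_theta_domain \<theta>"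
    and "f * g \<in> abs_theta_domain \<theta>"
  shows
    "(f \<in> O_K0 \<theta> \<and> g \<in> O_K0 \<theta> \<longrightarrow>
        abs_theta a \<theta> f * abs_theta a \<theta> g \<le> abs_theta a \<theta> (f * g) \<and>
        abs_theta a \<theta> (f * g) \<le> \<theta> * (abs_theta a \<theta> f * abs_theta a \<theta> g)) \<and>
     (f \<in> O_K1 \<theta> \<and> g \<in> O_K1 \<theta> \<longrightarrow>
        abs_theta a \<theta> f * abs_theta a \<theta> g \<le> abs_theta a \<theta> (f * g) \<and>
        abs_theta a \<theta> (f * g) \<le> \<theta>\<^sup>2 * (abs_theta a \<theta> f * abs_theta a \<theta> g)) \<and>
     (f \<in> O_K0 \<theta> \<and> g \<in> O_K1 \<theta> \<longrightarrow>
        abs_theta a \<theta> f * abs_theta a \<theta> g \<le> abs_theta a \<theta> (f * g) \<and>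
        abs_theta a \<theta> (f * g) \<le> \<theta> * (abs_theta a \<theta> f * abs_theta a \<theta> g))"
proof -
  interpret quadratic_unit a \<theta>
    using assms(1-3) by unfold_locales
  show ?thesis
    using abs_theta_mult_O_K0_O_K0 abs_theta_mult_O_K1_O_K1 abs_theta_mult_O_K0_O_K1 assms(6-8)
    by blast
qed


end
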